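(* Let $n\ge1$. For each $\sigma\in\mathcal{S}_n$, the distribution of the number of weak descents on $\mathcal{C}_n^\sigma$ is symmetric, in the sense that $$|\{\pi\in\mathcal{C}_n^\sigma:\mathrm{wdes}(\pi)-\mathrm{des}(\sigma)=r\}|=|\{\pi\in\mathcal{C}_n^\sigma:\mathrm{wdes}(\pi)-\mathrm{des}(\sigma)=n+1-r\}|$$ for all integers $r$.
   Context: Let $[n]=\{1,\dots,n\}$ and let $[n]\sqcup[n]=\{1,1,2,2,\dots,n,n\}$ be the multiset with two copies of each element of $[n]$. A permutation $\pi=\pi_1\pi_2\dots\pi_{2n}$ of $[n]\sqcup[n]$ is nonnesting if there do not exist $i<j<\ell<m$ with $\pi_i=\pi_m$ and $\pi_j=\pi_\ell$; equivalently, the subsequence of $\pi$ formed by the first (leftmost) copy of each entry coincides with the subsequence formed by the second copy of each entry. $\mathcal{C}_n$ denotes the set of nonnesting permutations of $[n]\sqcup[n]$, and for $\pi\in\mathcal{C}_n$ this common subsequence, a permutation in $\mathcal{S}_n$ (the set of permutations of $[n]$ in one-line notation), is denoted $s(\pi)$. For $\sigma\in\mathcal{S}_n$, $\mathcal{C}_n^\sigma=\{\pi\in\mathcal{C}_n:s(\pi)=\sigma\}$. For a word $\pi=\pi_1\dots\pi_m$ of positive integers, $\mathrm{des}(\pi)=|\{i\in[m-1]:\pi_i>\pi_{i+1}\}|$ and $\mathrm{wdes}(\pi)=|\{i\in[m-1]:\pi_i\ge\pi_{i+1}\}|$. *)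

theory Defs
  imports "HOL-Combinatorics.Multiset_Permutations"
begin

(* Permutations are words in one-line notation, i.e. lists of natural numbers with entries in
   {1..n}. The entries are 1-based as usual, but positions in a list are 0-based. *)

definition des :: "nat list \<Rightarrow> nat" where
  "des w = card {i. Suc i < length w \<and> w ! i > w ! Suc i}"

definition wdes :: "nat list \<Rightarrow> nat" where
  "wdes w = card {i. Suc i < length w \<and> w ! i \<ge> w ! Suc i}"

definition nonnesting :: "nat list \<Rightarrow> bool" where
  "nonnesting w \<longleftrightarrow>
     \<not> (\<exists>i j l m. i < j \<and> j < l \<and> l < m \<and> m < length w \<and> w ! i = w ! m \<and> w ! j = w ! l)"

definition sym_perms :: "nat \<Rightarrow> nat list set" where
  "sym_perms n = permutations_of_set {1..n}"

definition nonnesting_perms :: "nat \<Rightarrow> nat list set" where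
  "nonnesting_perms n =
     {w \<in> permutations_of_multiset (mset_set {1..n} + mset_set {1..n}). nonnesting w}"

(* The subsequence s(w) formed by the leftmost copy of each entry (the function remdups of the
   list library would keep the rightmost copies instead; for nonnesting permutations the two
   subsequences agree). *)
definition first_copies :: "nat list \<Rightarrow> nat list" where
  "first_copies w = nths w {i. i < length w \<and> w ! i \<notin> set (take i w)}"

definition nonnesting_perms_over :: "nat \<Rightarrow> nat list \<Rightarrow> nat list set" where
  "nonnesting_perms_over n \<sigma> = {w \<in> nonnesting_perms n. first_copies w = \<sigma>}"

end

theory Submission
  imports Defs
begin

text \<open>
  Words in \<open>C_n^\<sigma>\<close> are linear extensions of the ladder poset \<open>2 \<times> n\<close>, whose two
  rails are the first and the second copies in the order \<open>\<sigma>\<close>; weak descents become descents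
  once the label of each second copy is put just below that of its first copy. Two moves control
  the distribution of descents over linear extensions. Exchanging two labels adjacent in value on
  vertices not joined by an edge is compensated by exchanging these vertices whenever they are
  neighbours in the word, so only the orientation of the edges induced by the labels matters. Moving
  a block of lowest labels above all others shifts the number of descents by a constant, since
  passages into and out of the block alternate. Together they allow all edges across a cut to be
  reversed at the cost of a constant shift. Hence every labelling of the ladder that orients the
  rails alike and the rungs alike gives a shift of the same distribution; this applies to the
  labelling above and to its complement, and complementing labels exchanges ascents and descents.
\<close>

section \<open>Descents of words under a labelling\<close>

lemma des_Nil [simp]: "des [] = 0"
  and des_singleton [simp]: "des [a] = 0"
  by (simp_all add: des_def)

lemma card_Suc_shift:
  "card {i. Suc i < Suc m \<and> P i} = of_bool (0 < m \<and> P 0) + card {i. Suc i < m \<and> P (Suc i)}"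
proof -
  have eq: "{i. Suc i < Suc m \<and> P i} =
      (if 0 < m \<and> P 0 then {0} else {}) \<union> Suc ` {i. Suc i < m \<and> P (Suc i)}"
  proof (rule set_eqI)
    show "i \<in> {i. Suc i < Suc m \<and> P i} \<longleftrightarrow>
      i \<in> (if 0 < m \<and> P 0 then {0} else {}) \<union> Suc ` {i. Suc i < m \<and> P (Suc i)}" for i
      by (cases i) auto
  qed
  show ?thesis
    unfolding eq by (subst card_Un_disjoint) (auto simp: card_image intro: finite_subset[of _ "{..m}"])
qed

lemma des_Cons_Cons [simp]: "des (a # b # w) = of_bool (a > b) + des (b # w)"
  using card_Suc_shift[of "Suc (length w)" "\<lambda>i. (a # b # w) ! i > (a # b # w) ! Suc i"]
  by (simp add: des_def)

lemma des_map_cong: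
  assumes "\<And>x y. x \<in> set w \<Longrightarrow> y \<in> set w \<Longrightarrow> s x > s y \<longleftrightarrow> t x > t y"
  shows "des (map s w) = des (map t w)"
  using assms by (induction w rule: induct_list012) auto

text \<open>Each adjacent pair is a descent for exactly one of the two labellings. The bound
  \<open>M\<close> keeps truncated subtraction order-reversing.\<close>

lemma des_complement:
  assumes "distinct w" "inj_on s (set w)" "\<And>x. x \<in> set w \<Longrightarrow> s x \<le> M"
  shows "des (map (\<lambda>x. M - s x) w) + des (map s w) = length w - 1"
  using assms
proof (induction w rule: induct_list012)
  case (3 x y w)
  have "M - s x > M - s y \<longleftrightarrow> \<not> s x > s y"
    using 3(3-5) by (auto simp: inj_on_def) (metis diff_less_mono2 less_le_trans nat_neq_iff)
  moreover have "des (map (\<lambda>x. M - s x) (y # w)) + des (map s (y # w)) = length (y # w) - 1"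
    using 3 by (intro 3) (auto simp: inj_on_def)
  ultimately show ?case by (cases "s x > s y") auto
qed auto

section \<open>Descents of labelled linear extensions\<close>

text \<open>\<open>E\<close> may consist of cover relations only: forbidding backward edges forces
  the generated order, since every vertex occurs in the word.\<close>

definition lin_exts :: "'a set \<Rightarrow> ('a \<times> 'a) set \<Rightarrow> 'a list set" where
  "lin_exts V E = {w. distinct w \<and> set w = V \<and> sorted_wrt (\<lambda>x y. (y, x) \<notin> E) w}"

text \<open>The argument \<open>r\<close> is an integer so that distributions can be shifted without
  truncation.\<close>

definition des_count :: "'a set \<Rightarrow> ('a \<times> 'a) set \<Rightarrow> ('a \<Rightarrow> nat) \<Rightarrow> int \<Rightarrow> nat" where
  "des_count V E s r = card {w \<in> lin_exts V E. int (des (map s w)) = r}"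

section \<open>Exchanging labels adjacent in value\<close>

fun toggle :: "'a \<Rightarrow> 'a \<Rightarrow> 'a list \<Rightarrow> 'a list" where
  "toggle x y (u # v # w) = (if {u, v} = {x, y} then v # u # w else u # toggle x y (v # w))"
| "toggle x y w = w"

lemma set_toggle [simp]: "set (toggle x y w) = set w"
  by (induction x y w rule: toggle.induct) auto

lemma distinct_toggle [simp]: "distinct (toggle x y w) = distinct w"
  by (induction x y w rule: toggle.induct) auto

lemma sorted_wrt_toggle:
  assumes "sorted_wrt R w" "R x y" "R y x"
  shows "sorted_wrt R (toggle x y w)"
  using assms
  by (induction x y w rule: toggle.induct) (auto simp: doubleton_eq_iff)

lemma toggle_toggle:
  assumes "distinct w"
  shows "toggle x y (toggle x y w) = w"
  using assms
proof (induction x y w rule: toggle.induct)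
  case (1 x y u v w)
  show ?case
  proof (cases "{u, v} = {x, y}")
    case True
    then show ?thesis by (auto simp: insert_commute)
  next
    case False
    have IH: "toggle x y (toggle x y (v # w)) = v # w" using 1 False by auto
    obtain v' w' where t: "toggle x y (v # w) = v' # w'"
      by (metis list.exhaust set_toggle set_empty list.distinct(1))
    \<comment> \<open>The second pass must not stop earlier than the first. If the head of the tail
      has changed, both \<open>x\<close> and \<open>y\<close> lie in the tail, so \<open>u\<close>
      is neither of them.\<close>
    have "{u, v'} \<noteq> {x, y}"
    proof (cases w)
      case Nil then show ?thesis using t False by auto
    next
      case (Cons z zs)
      then show ?thesis using t False 1(2) by (auto simp: doubleton_eq_iff split: if_splits)
    qed
    then show ?thesis using False IH t by auto
  qed
qed auto

lemma toggle_in_lin_exts: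
  assumes "w \<in> lin_exts V E" "(x, y) \<notin> E" "(y, x) \<notin> E"
  shows "toggle x y w \<in> lin_exts V E"
  using assms by (auto simp: lin_exts_def intro: sorted_wrt_toggle)

text \<open>If \<open>x\<close> and \<open>y\<close> are neighbours in \<open>w\<close>, the two
  exchanges cancel and the label words coincide. Otherwise \<open>x\<close> and \<open>y\<close> are
  compared only with third elements, which lie on the same side of both labels.\<close>

lemma des_map_toggle:
  assumes "distinct w" "s' x = s y" "s' y = s x"
    and "\<And>z. z \<in> set w \<Longrightarrow> z \<noteq> x \<Longrightarrow> z \<noteq> y \<Longrightarrow> s' z = s z"
    and "\<And>z. z \<in> set w \<Longrightarrow> z \<noteq> x \<Longrightarrow> z \<noteq> y \<Longrightarrow> s z < s x \<longleftrightarrow> s z < s y"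
    and "\<And>z. z \<in> set w \<Longrightarrow> z \<noteq> x \<Longrightarrow> z \<noteq> y \<Longrightarrow> s x < s z \<longleftrightarrow> s y < s z"
  shows "des (map s' (toggle x y w)) = des (map s w)"
  using assms
proof (induction x y w rule: toggle.induct)
  case (1 x y u v w)
  show ?case
  proof (cases "{u, v} = {x, y}")
    case True
    have *: "map s' w = map s w"
      using True 1(2) 1(5) by (intro map_cong) (auto simp: doubleton_eq_iff)
    have "map s' (toggle x y (u # v # w)) = map s (u # v # w)"
      using True 1(3,4) * by (auto simp: doubleton_eq_iff)
    then show ?thesis by simp
  next
    case False
    have IH: "des (map s' (toggle x y (v # w))) = des (map s (v # w))"
      by (rule "1.IH"[OF False]) (use 1 in auto)
    obtain v' w' where t: "toggle x y (v # w) = v' # w'"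
      by (metis list.exhaust set_toggle set_empty list.distinct(1))
    \<comment> \<open>The head of the tail changes only when the exchange happens right there; then
      \<open>v'\<close> carries under \<open>s'\<close> the label that \<open>v\<close> had under
      \<open>s\<close>.\<close>
    have "s' u > s' v' \<longleftrightarrow> s u > s v"
    proof (cases "v' = v")
      case True
      have "u \<noteq> v" using "1.prems"(1) by simp
      then consider "u = x" "v \<noteq> x" "v \<noteq> y" | "u = y" "v \<noteq> x" "v \<noteq> y"
        | "v = x" "u \<noteq> x" "u \<noteq> y" | "v = y" "u \<noteq> x" "u \<noteq> y"
        | "u \<noteq> x" "u \<noteq> y" "v \<noteq> x" "v \<noteq> y"
        using False by blast
      then show ?thesis
        using True "1.prems"(2,3) "1.prems"(4-6)[of u] "1.prems"(4-6)[of v]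
        by cases simp_all
    next
      case neq: False
      obtain z zs where w: "w = z # zs" using t neq by (cases w) auto
      then have "{v, z} = {x, y}" "v' = z"
        using t neq by (auto split: if_splits)
      then have "s' v' = s v" using "1.prems"(2,3) by (auto simp: doubleton_eq_iff)
      moreover have "s' u = s u"
        using \<open>{v, z} = {x, y}\<close> w "1.prems"(1) "1.prems"(4)[of u] by (auto simp: doubleton_eq_iff)
      ultimately show ?thesis by simp
    qed
    then show ?thesis using False IH t by simp
  qed
qed auto

text \<open>\<open>toggle x y\<close> is an involution on linear extensions because \<open>x\<close>
  and \<open>y\<close> are not joined by an edge, and it carries descents for \<open>s\<close> to
  descents for the swapped labelling.\<close>

lemma des_count_swap_labels:
  assumes "(x, y) \<notin> E" "(y, x) \<notin> E" "x \<in> V" "y \<in> V" "inj_on s V" "s x < s y"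
    and adj: "\<And>z. z \<in> V \<Longrightarrow> \<not> (s x < s z \<and> s z < s y)"
  shows "des_count V E (s(x := s y, y := s x)) r = des_count V E s r"
proof -
  let ?s' = "s(x := s y, y := s x)"
  have des: "des (map ?s' (toggle x y w)) = des (map s w)" if "w \<in> lin_exts V E" for w
  proof (rule des_map_toggle)
    fix z assume z: "z \<in> set w" "z \<noteq> x" "z \<noteq> y"
    then have "z \<in> V" "s z \<noteq> s x" "s z \<noteq> s y"
      using that assms by (auto simp: lin_exts_def inj_on_def)
    then show "s z < s x \<longleftrightarrow> s z < s y" "s x < s z \<longleftrightarrow> s y < s z"
      using adj[of z] \<open>s x < s y\<close> by auto
  qed (use that assms(6) in \<open>auto simp: lin_exts_def\<close>)
  have tt: "toggle x y (toggle x y w) = w" if "w \<in> lin_exts V E" for w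
    using that by (intro toggle_toggle) (auto simp: lin_exts_def)
  have tl: "toggle x y w \<in> lin_exts V E" if "w \<in> lin_exts V E" for w
    using that assms(1,2) by (rule toggle_in_lin_exts)
  have "bij_betw (toggle x y) {w \<in> lin_exts V E. int (des (map s w)) = r}
      {w \<in> lin_exts V E. int (des (map ?s' w)) = r}"
  proof (rule bij_betw_byWitness[where f' = "toggle x y"])
    show "toggle x y ` {w \<in> lin_exts V E. int (des (map s w)) = r}
        \<subseteq> {w \<in> lin_exts V E. int (des (map ?s' w)) = r}"
      using tl des by auto
    show "toggle x y ` {w \<in> lin_exts V E. int (des (map ?s' w)) = r}
        \<subseteq> {w \<in> lin_exts V E. int (des (map s w)) = r}"
      using tl des[OF tl] tt by auto
  qed (use tt in auto)
  then show ?thesis unfolding des_count_def by (rule bij_betw_same_card[symmetric])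
qed

text \<open>Sort \<open>s\<close> into the order of \<open>t\<close> by swaps of labels adjacent in
  value. A pair on which \<open>s\<close> and \<open>t\<close> disagree is never an edge, so each
  such swap is allowed, and it lowers the number of disagreements.\<close>

lemma des_count_eq_if_same_orientation:
  assumes "finite V" "E \<subseteq> V \<times> V" "inj_on s V" "inj_on t V"
    and "\<And>x y. (x, y) \<in> E \<Longrightarrow> s x < s y \<longleftrightarrow> t x < t y"
  shows "des_count V E s r = des_count V E t r"
  using assms(3,5)
proof (induction "card {(x, y). x \<in> V \<and> y \<in> V \<and> s x < s y \<and> t y < t x}"
    arbitrary: s rule: less_induct)
  case less
  let ?B = "\<lambda>s. {(x, y). x \<in> V \<and> y \<in> V \<and> s x < s y \<and> t y < t x}"
  have fin: "finite (?B s)" for s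
    by (rule finite_subset[of _ "V \<times> V"]) (use assms(1) in auto)
  show ?case
  proof (cases "?B s = {}")
    case True
    have "des (map s w) = des (map t w)" if "w \<in> lin_exts V E" for w
    proof (rule des_map_cong)
      fix x y assume "x \<in> set w" "y \<in> set w"
      then have "x \<in> V" "y \<in> V" using that by (auto simp: lin_exts_def)
      then show "s y < s x \<longleftrightarrow> t y < t x"
        using True less(2) assms(4) by (auto simp: inj_on_def) (metis nat_neq_iff)+
    qed
    then show ?thesis unfolding des_count_def by (metis (no_types, lifting))
  next
    case False
    define gap where "gap = (\<lambda>p. s (snd p) - s (fst p))"
    \<comment> \<open>A disagreeing pair with the smallest gap has no label in between, as such a label would
      form a closer disagreeing pair with one of its ends.\<close>
    obtain p where p: "p \<in> ?B s" "\<And>q. q \<in> ?B s \<Longrightarrow> gap p \<le> gap q"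
      using that[OF arg_min_if_finite(1)[OF fin False] arg_min_least[OF fin False]] .
    obtain x y where xy: "p = (x, y)" by force
    have b: "x \<in> V" "y \<in> V" "s x < s y" "t y < t x" using p xy by auto
    have adj: "\<not> (s x < s z \<and> s z < s y)" if "z \<in> V" for z
    proof
      assume z: "s x < s z \<and> s z < s y"
      have "t z \<noteq> t x" using z assms(4) that b by (auto simp: inj_on_def)
      then consider "t z < t x" | "t y < t z" using b by linarith
      then show False
      proof cases
        case 1
        then have "(x, z) \<in> ?B s" using that z b by auto
        from p(2)[OF this] show False using z b unfolding gap_def xy fst_conv snd_conv by linarith
      next
        case 2
        then have "(z, y) \<in> ?B s" using that z b by auto
        from p(2)[OF this] show False using z b unfolding gap_def xy fst_conv snd_conv by linarith
      qed
    qed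
    have nE: "(x, y) \<notin> E" "(y, x) \<notin> E" using less(3)[of x y] less(3)[of y x] b by auto
    define s' where "s' = s(x := s y, y := s x)"
    have neq: "x \<noteq> y" using b by auto
    have inj: "inj_on s' V"
      using less(2) b neq unfolding s'_def inj_on_def by (auto split: if_splits)
    \<comment> \<open>As no label lies between those of \<open>x\<close> and \<open>y\<close>, the
      swap alters only the comparison of \<open>x\<close> with \<open>y\<close>, so exactly this
      disagreement disappears.\<close>
    have cmp: "s' u < s' v \<longleftrightarrow> s u < s v"
      if "u \<in> V" "v \<in> V" "(u, v) \<noteq> (x, y)" "(u, v) \<noteq> (y, x)" for u v
    proof -
      have "z \<noteq> x \<Longrightarrow> s z \<noteq> s x" "z \<noteq> y \<Longrightarrow> s z \<noteq> s y" if "z \<in> V" for z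
        using less(2) that b by (auto simp: inj_on_def)
      note this[OF \<open>u \<in> V\<close>] this[OF \<open>v \<in> V\<close>] adj[OF \<open>u \<in> V\<close>] adj[OF \<open>v \<in> V\<close>]
      then show ?thesis using that(3,4) b neq unfolding s'_def
        by (cases "u = x"; cases "u = y"; cases "v = x"; cases "v = y") auto
    qed
    have "?B s' \<subseteq> ?B s - {(x, y)}"
    proof (rule subsetI)
      fix q assume q: "q \<in> ?B s'"
      obtain u v where uv: "q = (u, v)" by force
      have "(u, v) \<noteq> (x, y)" "(u, v) \<noteq> (y, x)"
        using q uv b neq by (auto simp: s'_def)
      then show "q \<in> ?B s - {(x, y)}" using q cmp[of u v] by (simp add: uv)
    qed
    moreover have "(x, y) \<in> ?B s" using b by auto
    ultimately have "card (?B s') < card (?B s)"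
      using fin by (intro psubset_card_mono) blast+
    then have "des_count V E s' r = des_count V E t r"
    proof (rule less(1)[OF _ inj])
      fix u v assume uv: "(u, v) \<in> E"
      then have "(u, v) \<noteq> (x, y)" "(u, v) \<noteq> (y, x)" "u \<in> V" "v \<in> V" using nE assms(2) by auto
      then show "s' u < s' v \<longleftrightarrow> t u < t v" using cmp less(3)[OF uv] by simp
    qed
    moreover have "des_count V E s' r = des_count V E s r"
      unfolding s'_def by (rule des_count_swap_labels) (use nE b less(2) adj in auto)
    ultimately show ?thesis by simp
  qed
qed

section \<open>Reversing the edges across a cut\<close>

lemma des_map_rotate:
  assumes "w \<noteq> []" "\<And>v. v \<in> set w \<Longrightarrow> s v < N"
  shows "int (des (map (\<lambda>v. if v \<in> X then s v + N else s v) w)) =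
    int (des (map (\<lambda>v. if v \<in> X then s v else s v + N) w))
      + of_bool (hd w \<in> X) - of_bool (last w \<in> X)"
  using assms
proof (induction w rule: induct_list012)
  case (3 x y w)
  have *: "s x < N" "s y < N" using 3(4) by auto
  note IH = 3(2)[OF _ 3(4)]
  \<comment> \<open>Steps within \<open>X\<close> or within its complement count alike on both
    sides. An exit from \<open>X\<close> is a descent only when \<open>X\<close> is raised, an entry
    only when the complement is; the difference telescopes to the end letters.\<close>
  show ?case using * IH by (cases "x \<in> X"; cases "y \<in> X") auto
qed auto

text \<open>Every edge across the cut has its smaller label in \<open>X\<close>, and raising
  \<open>X\<close> reverses all of them. A common first and last letter makes the shift the same for
  all words.\<close>

lemma des_count_cut:
  assumes "finite V" "E \<subseteq> V \<times> V" "inj_on s V" "\<And>v. v \<in> V \<Longrightarrow> s v < N"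
    and "\<And>x y. (x, y) \<in> E \<Longrightarrow> x \<in> X \<Longrightarrow> y \<notin> X \<Longrightarrow> s x < s y"
    and "\<And>x y. (x, y) \<in> E \<Longrightarrow> x \<notin> X \<Longrightarrow> y \<in> X \<Longrightarrow> s y < s x"
    and "V \<noteq> {}" "\<And>w. w \<in> lin_exts V E \<Longrightarrow> hd w = a \<and> last w = b"
  shows "des_count V E s r =
    des_count V E (\<lambda>v. if v \<in> X then s v + N else s v) (r + of_bool (a \<in> X) - of_bool (b \<in> X))"
proof -
  \<comment> \<open>This intermediate labelling places \<open>X\<close> below everything else, yet
    orients all edges as \<open>s\<close> does.\<close>
  let ?l = "\<lambda>v. if v \<in> X then s v else s v + N"
  have "des_count V E s r = des_count V E ?l r"
  proof (rule des_count_eq_if_same_orientation[OF assms(1-3)])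
    show "inj_on ?l V"
    proof (rule inj_onI)
      fix x y assume "x \<in> V" "y \<in> V" "?l x = ?l y"
      then show "x = y"
        using assms(4)[of x] assms(4)[of y] inj_onD[OF assms(3), of x y] by (auto split: if_splits)
    qed
  next
    fix x y assume e: "(x, y) \<in> E"
    then have "x \<in> V" "y \<in> V" using assms(2) by auto
    then show "s x < s y \<longleftrightarrow> ?l x < ?l y"
      using assms(4)[of x] assms(4)[of y] assms(5)[OF e] assms(6)[OF e] by auto
  qed
  also have "\<dots> = des_count V E (\<lambda>v. if v \<in> X then s v + N else s v)
      (r + of_bool (a \<in> X) - of_bool (b \<in> X))"
  proof -
    have "int (des (map (\<lambda>v. if v \<in> X then s v + N else s v) w)) =
        int (des (map ?l w)) + of_bool (a \<in> X) - of_bool (b \<in> X)" if "w \<in> lin_exts V E" for w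
      using des_map_rotate[of w s N X] assms(8)[OF that] that assms(4,7)
      by (auto simp: lin_exts_def)
    then show ?thesis unfolding des_count_def
      by (intro arg_cong[of _ _ card] Collect_cong conj_cong refl) simp
  qed
  finally show ?thesis .
qed


section \<open>The ladder\<close>

text \<open>The vertex \<open>(i, False)\<close> stands for the first and \<open>(i, True)\<close> for the second copy of
  \<open>\<sigma> ! i\<close>.\<close>

definition ladder :: "nat \<Rightarrow> (nat \<times> bool) set" where
  "ladder n = {..<n} \<times> UNIV"

definition ladder_edges :: "nat \<Rightarrow> ((nat \<times> bool) \<times> (nat \<times> bool)) set" where
  "ladder_edges n = {((i, b), (Suc i, b)) | i b. Suc i < n} \<union> {((i, False), (i, True)) | i. i < n}"

text \<open>The descending edges then group into whole cuts: two parallel rail edges between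
  neighbouring columns, or all rungs at once.\<close>

definition parallel :: "nat \<Rightarrow> (nat \<times> bool \<Rightarrow> nat) \<Rightarrow> bool" where
  "parallel n s \<longleftrightarrow> inj_on s (ladder n) \<and>
     (\<forall>i. Suc i < n \<longrightarrow> (s (i, False) < s (Suc i, False) \<longleftrightarrow> s (i, True) < s (Suc i, True))) \<and>
     (\<forall>i<n. s (i, False) < s (i, True) \<longleftrightarrow> s (0, False) < s (0, True))"

definition inverted_columns :: "nat \<Rightarrow> (nat \<times> bool \<Rightarrow> nat) \<Rightarrow> nat set" where
  "inverted_columns n s = {i. Suc i < n \<and> s (i, False) > s (Suc i, False)}"

text \<open>The number of cuts whose reversal makes all edges ascend: one for each descending pair of
  parallel rail edges, and one for all rungs together.\<close>

definition cut_number :: "nat \<Rightarrow> (nat \<times> bool \<Rightarrow> nat) \<Rightarrow> nat" where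
  "cut_number n s = card (inverted_columns n s) + of_bool (s (0, True) < s (0, False))"

lemma finite_ladder: "finite (ladder n)"
  by (simp add: ladder_def)

lemma ladder_nonempty: "n > 0 \<Longrightarrow> ladder n \<noteq> {}"
  unfolding ladder_def by blast

lemma ladder_edges_subset: "ladder_edges n \<subseteq> ladder n \<times> ladder n"
  by (auto simp: ladder_edges_def ladder_def)

lemma finite_inverted_columns [simp]: "finite (inverted_columns n s)"
  by (rule finite_subset[of _ "{..<n}"]) (auto simp: inverted_columns_def)

section \<open>Source, sink and cuts of the ladder\<close>

lemma hd_lin_exts_ladder:
  assumes "w \<in> lin_exts (ladder n) (ladder_edges n)" "n > 0"
  shows "hd w = (0, False)"
proof (rule ccontr)
  assume ne: "hd w \<noteq> (0, False)"
  have "w \<noteq> []" using assms(1) ladder_nonempty[OF assms(2)] by (auto simp: lin_exts_def)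
  then obtain x xs where w: "w = x # xs" by (cases w) auto
  obtain i b where x: "x = (i, b)" by force
  have "i < n" using assms(1) w x by (auto simp: lin_exts_def ladder_def)
  \<comment> \<open>Every vertex except \<open>(0, False)\<close> has an incoming edge, whose tail
    would have to precede the head of the word.\<close>
  obtain y where y: "(y, x) \<in> ladder_edges n" "y \<noteq> x"
  proof (cases b)
    case True
    then show ?thesis using that[of "(i, False)"] \<open>i < n\<close> x by (auto simp: ladder_edges_def)
  next
    case False
    then obtain j where "i = Suc j" using ne w x by (cases i) auto
    then show ?thesis using that[of "(j, b)"] \<open>i < n\<close> x by (auto simp: ladder_edges_def)
  qed
  then have "y \<in> ladder n" using ladder_edges_subset by blast
  then show False using y assms(1) w by (auto simp: lin_exts_def)
qed

lemma last_lin_exts_ladder: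
  assumes "w \<in> lin_exts (ladder n) (ladder_edges n)" "n > 0"
  shows "last w = (n - 1, True)"
proof (rule ccontr)
  assume ne: "last w \<noteq> (n - 1, True)"
  have "w \<noteq> []" using assms(1) ladder_nonempty[OF assms(2)] by (auto simp: lin_exts_def)
  then obtain x xs where w: "w = xs @ [x]" by (cases w rule: rev_cases) auto
  obtain i b where x: "x = (i, b)" by force
  have "i < n" using assms(1) w x by (auto simp: lin_exts_def ladder_def)
  \<comment> \<open>Dually, every vertex except \<open>(n - 1, True)\<close> has an outgoing
    edge.\<close>
  obtain y where y: "(x, y) \<in> ladder_edges n" "y \<noteq> x"
  proof (cases b)
    case False
    then show ?thesis using that[of "(i, True)"] \<open>i < n\<close> x by (auto simp: ladder_edges_def)
  next
    case True
    then have "Suc i < n" using ne w x \<open>i < n\<close> by auto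
    then show ?thesis using that[of "(Suc i, b)"] \<open>i < n\<close> x by (auto simp: ladder_edges_def)
  qed
  then have "y \<in> ladder n" using ladder_edges_subset by blast
  then show False using y assms(1) w by (auto simp: lin_exts_def sorted_wrt_append)
qed

text \<open>All words begin at the source, outside \<open>X\<close>, and end at the sink, inside
  \<open>X\<close>, so reversing the cut costs exactly one descent.\<close>

lemma des_count_ladder_cut:
  assumes "n > 0" "inj_on s (ladder n)" "\<And>v. v \<in> ladder n \<Longrightarrow> s v < N"
    and "\<And>x y. (x, y) \<in> ladder_edges n \<Longrightarrow> x \<in> X \<longleftrightarrow> y \<notin> X \<Longrightarrow> y \<in> X \<and> s y < s x"
    and "(0, False) \<notin> X" "(n - 1, True) \<in> X"
  shows "des_count (ladder n) (ladder_edges n) s r =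
    des_count (ladder n) (ladder_edges n) (\<lambda>v. if v \<in> X then s v + N else s v) (r - 1)"
proof -
  have "des_count (ladder n) (ladder_edges n) s r =
      des_count (ladder n) (ladder_edges n) (\<lambda>v. if v \<in> X then s v + N else s v)
        (r + of_bool ((0, False) \<in> X) - of_bool ((n - 1, True) \<in> X))"
  proof (rule des_count_cut[OF finite_ladder ladder_edges_subset assms(2,3)])
    show "ladder n \<noteq> {}" using assms(1) by (rule ladder_nonempty)
  qed (use assms(4) hd_lin_exts_ladder last_lin_exts_ladder assms(1) in blast)+
  then show ?thesis using assms(5,6) by simp
qed

text \<open>Reverse one descending cut at a time; each removes one descent from every level of the
  distribution and lowers \<open>cut_number\<close> by one. Without such cuts all edges ascend, as
  in the reference labelling \<open>2 * i + of_bool b\<close>.\<close>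

lemma des_count_parallel:
  assumes "n > 0" "parallel n s"
  shows "des_count (ladder n) (ladder_edges n) s (r + int (cut_number n s)) =
    des_count (ladder n) (ladder_edges n) (\<lambda>(i, b). 2 * i + of_bool b) r"
  using assms(2)
proof (induction "cut_number n s" arbitrary: s r rule: less_induct)
  case less
  note inj = less(2)[unfolded parallel_def, THEN conjunct1]
  note cols = less(2)[unfolded parallel_def, THEN conjunct2, THEN conjunct1, rule_format]
  note rungs = less(2)[unfolded parallel_def, THEN conjunct2, THEN conjunct2, rule_format]
  have neq: "s u \<noteq> s v" if "u \<in> ladder n" "v \<in> ladder n" "u \<noteq> v" for u v
    using inj that by (auto simp: inj_on_def)
  obtain N where N: "\<And>v. v \<in> ladder n \<Longrightarrow> s v < N"
    using finite_ladder[of n] by (metis finite_imageI finite_nat_set_iff_bounded imageI)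
  have step: ?case
    if X: "\<And>x y. (x, y) \<in> ladder_edges n \<Longrightarrow> x \<in> X \<longleftrightarrow> y \<notin> X \<Longrightarrow> y \<in> X \<and> s y < s x"
      and ends: "(0, False) \<notin> X" "(n - 1, True) \<in> X"
      and t: "t = (\<lambda>v. if v \<in> X then s v + N else s v)"
      and par: "parallel n t" and cut: "Suc (cut_number n t) = cut_number n s" for X t
  proof -
    have "des_count (ladder n) (ladder_edges n) s (r + int (cut_number n s)) =
        des_count (ladder n) (ladder_edges n) t (r + int (cut_number n s) - 1)"
      unfolding t using des_count_ladder_cut[OF \<open>n > 0\<close> inj N X ends] .
    also have "r + int (cut_number n s) - 1 = r + int (cut_number n t)"
      using cut by simp
    also have "des_count (ladder n) (ladder_edges n) t (r + int (cut_number n t)) =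
        des_count (ladder n) (ladder_edges n) (\<lambda>(i, b). 2 * i + of_bool b) r"
      by (rule less(1)) (use cut par in simp_all)
    finally show ?case .
  qed
  have lift_inj: "inj_on (\<lambda>v. if v \<in> X then s v + N else s v) (ladder n)" for X
  proof (rule inj_onI)
    fix x y assume "x \<in> ladder n" "y \<in> ladder n"
      "(if x \<in> X then s x + N else s x) = (if y \<in> X then s y + N else s y)"
    then show "x = y"
      using N[of x] N[of y] inj_onD[OF inj, of x y] by (auto split: if_splits)
  qed
  have N': "s (i, b) < N" if "i < n" for i b
    using N that by (auto simp: ladder_def)
  consider (rung) "s (0, True) < s (0, False)"
    | (col) p where "Suc p < n" "s (Suc p, False) < s (p, False)"
    | (none) "s (0, False) < s (0, True)" "\<And>i. Suc i < n \<Longrightarrow> s (i, False) < s (Suc i, False)"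
  proof -
    have "s (0, True) \<noteq> s (0, False)" using \<open>n > 0\<close> by (intro neq) (auto simp: ladder_def)
    moreover have "s (i, False) \<noteq> s (Suc i, False)" if "Suc i < n" for i
      using that by (intro neq) (auto simp: ladder_def)
    ultimately show ?thesis using that by (meson linorder_neqE_nat)
  qed
  then show ?case
  proof cases
    case rung
    \<comment> \<open>The second rail: the edges crossing this cut are exactly the rungs, all
      descending.\<close>
    define X where "X = {v :: nat \<times> bool. snd v}"
    define t where "t = (\<lambda>v. if v \<in> X then s v + N else s v)"
    show ?thesis
    proof (rule step[OF _ _ _ t_def])
      fix x y assume "(x, y) \<in> ladder_edges n" "x \<in> X \<longleftrightarrow> y \<notin> X"
      then obtain i where i: "x = (i, False)" "y = (i, True)" "i < n"
        by (auto simp: ladder_edges_def X_def)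
      have "s (i, True) \<noteq> s (i, False)" using i by (intro neq) (auto simp: ladder_def)
      then show "y \<in> X \<and> s y < s x" using rung i rungs[of i] by (auto simp: X_def)
    next
      have *: "s (i, False) < s (i, True) + N" if "i < n" for i using N'[OF that, of False] by simp
      show "parallel n t"
        using lift_inj[of X] cols * \<open>n > 0\<close> unfolding parallel_def t_def X_def by simp
      show "Suc (cut_number n t) = cut_number n s"
        using rung *[OF \<open>n > 0\<close>] unfolding cut_number_def inverted_columns_def t_def X_def by simp
    qed (auto simp: X_def)
  next
    case col
    \<comment> \<open>The columns after \<open>p\<close>: only the two rail edges from column
      \<open>p\<close> to column \<open>Suc p\<close> cross this cut.\<close>
    define X where "X = {v :: nat \<times> bool. p < fst v}"
    define t where "t = (\<lambda>v. if v \<in> X then s v + N else s v)"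
    have p: "s (Suc p, b) < s (p, b)" for b
    proof -
      have "s (Suc p, True) \<noteq> s (p, True)"
        using col by (intro neq) (auto simp: ladder_def)
      then show ?thesis using col cols[OF col(1)] by (cases b) auto
    qed
    have ord: "t (i, b) < t (Suc i, b) \<longleftrightarrow> i = p \<or> s (i, b) < s (Suc i, b)"
      "t (Suc i, b) < t (i, b) \<longleftrightarrow> i \<noteq> p \<and> s (Suc i, b) < s (i, b)"
      if "Suc i < n" for i b
      using N'[of i b] that p[of b] by (auto simp: t_def X_def)
    show ?thesis
    proof (rule step[OF _ _ _ t_def])
      fix x y assume "(x, y) \<in> ladder_edges n" "x \<in> X \<longleftrightarrow> y \<notin> X"
      then obtain b where "x = (p, b)" "y = (Suc p, b)"
        by (auto simp: ladder_edges_def X_def less_Suc_eq)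
      then show "y \<in> X \<and> s y < s x" using p by (auto simp: X_def)
    next
      show "parallel n t" unfolding parallel_def
      proof (intro conjI allI impI)
        show "inj_on t (ladder n)" unfolding t_def by (rule lift_inj)
      next
        fix i assume "Suc i < n"
        then show "t (i, False) < t (Suc i, False) \<longleftrightarrow> t (i, True) < t (Suc i, True)"
          using cols[of i] ord(1)[of i] by blast
      next
        fix i assume "i < n"
        from rungs[OF this]
        show "t (i, False) < t (i, True) \<longleftrightarrow> t (0, False) < t (0, True)"
          by (simp add: t_def X_def)
      qed
      have "inverted_columns n s = insert p (inverted_columns n t)" "p \<notin> inverted_columns n t"
        using ord(2)[of _ False] col by (auto simp: inverted_columns_def)
      then show "Suc (cut_number n t) = cut_number n s"
        unfolding cut_number_def by (simp add: t_def X_def)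
    qed (use col in \<open>auto simp: X_def\<close>)
  next
    case none
    have "inverted_columns n s = {}"
      using none(2) by (fastforce simp: inverted_columns_def)
    with none(1) have c0: "cut_number n s = 0"
      by (simp add: cut_number_def)
    have up: "s x < s y" if e: "(x, y) \<in> ladder_edges n" for x y
    proof -
      consider i b where "x = (i, b)" "y = (Suc i, b)" "Suc i < n"
        | i where "x = (i, False)" "y = (i, True)" "i < n"
        using e by (auto simp: ladder_edges_def)
      then show ?thesis
      proof cases
        case (1 i b)
        then show ?thesis using none(2)[of i] cols[of i] by (cases b) auto
      next
        case (2 i)
        then show ?thesis using none(1) rungs[of i] by auto
      qed
    qed
    have "des_count (ladder n) (ladder_edges n) s r =
        des_count (ladder n) (ladder_edges n) (\<lambda>(i, b). 2 * i + of_bool b) r"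
    proof (rule des_count_eq_if_same_orientation[OF finite_ladder ladder_edges_subset inj])
      show "inj_on (\<lambda>(i, b). 2 * i + of_bool b :: nat) (ladder n)"
        by (auto simp: inj_on_def of_bool_def split: if_splits) presburger+
      show "s x < s y \<longleftrightarrow> (\<lambda>(i, b). 2 * i + of_bool b :: nat) x < (\<lambda>(i, b). 2 * i + of_bool b) y"
        if "(x, y) \<in> ladder_edges n" for x y
        using up[OF that] that by (auto simp: ladder_edges_def)
    qed
    then show ?thesis using c0 by simp
  qed
qed


section \<open>Nonnesting permutations as linear extensions of the ladder\<close>

text \<open>Edges join only neighbouring columns, so the order along a rail is obtained by induction
  on \<open>j\<close>, through the position of the preceding vertex of that rail.\<close>

lemma ladder_order:
  assumes "w \<in> lin_exts (ladder n) (ladder_edges n)" "k < length w" "l < length w"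
    and "w ! k = (i, b)" "w ! l = (j, b)" "i < j"
  shows "k < l"
  using assms
proof (induction j arbitrary: l)
  case (Suc j)
  have sorted: "(w ! m', w ! m) \<notin> ladder_edges n" if "m < m'" "m' < length w" for m m'
    using Suc.prems(1) that by (auto simp: lin_exts_def sorted_wrt_iff_nth_less)
  have "Suc j < n"
    using Suc.prems(1,3,5) nth_mem[of l w] by (auto simp: lin_exts_def ladder_def)
  then have "(j, b) \<in> set w" using Suc.prems(1) by (auto simp: lin_exts_def ladder_def)
  then obtain m where m: "m < length w" "w ! m = (j, b)" by (auto simp: in_set_conv_nth)
  have "(w ! m, w ! l) \<in> ladder_edges n"
    using m Suc.prems(5) \<open>Suc j < n\<close> by (auto simp: ladder_edges_def)
  then have "m < l"
    using sorted[of l m] m Suc.prems(5) by (cases m l rule: linorder_cases) auto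
  moreover have "k \<le> m"
  proof (cases "i = j")
    case True
    then have "k = m"
      using Suc.prems(1,2,4) m nth_eq_iff_index_eq[of w k m] by (simp add: lin_exts_def)
    then show ?thesis by simp
  next
    case False
    then show ?thesis using Suc.IH[of m] Suc.prems m by simp
  qed
  ultimately show ?case by simp
qed simp

lemma ladder_order_rung:
  assumes "w \<in> lin_exts (ladder n) (ladder_edges n)" "k < length w" "l < length w"
    and "w ! k = (i, False)" "w ! l = (i, True)"
  shows "k < l"
proof -
  have "i < n"
    using assms(1,2,4) nth_mem[of k w] by (auto simp: lin_exts_def ladder_def)
  then have "(w ! k, w ! l) \<in> ladder_edges n" using assms(4,5) by (auto simp: ladder_edges_def)
  then have "\<not> l < k"
    using assms(1,2) by (auto simp: lin_exts_def sorted_wrt_iff_nth_less)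
  then show ?thesis using assms(4,5) by (cases k l rule: linorder_cases) auto
qed

lemma first_copies_conv_filter:
  "first_copies w = map ((!) w) (filter (\<lambda>i. w ! i \<notin> set (take i w)) [0..<length w])"
proof -
  have z: "zip w [0..<length w] = map (\<lambda>i. (w ! i, i)) [0..<length w]"
    by (rule nth_equalityI) auto
  have "first_copies w = map ((!) w)
      (filter (\<lambda>i. i < length w \<and> w ! i \<notin> set (take i w)) [0..<length w])"
    by (simp add: first_copies_def nths_def z filter_map comp_def)
  also have "filter (\<lambda>i. i < length w \<and> w ! i \<notin> set (take i w)) [0..<length w] =
      filter (\<lambda>i. w ! i \<notin> set (take i w)) [0..<length w]"
    by (rule filter_cong) auto
  finally show ?thesis .
qed

lemma in_set_take_conv_nth:
  "k \<le> length w \<Longrightarrow> x \<in> set (take k w) \<longleftrightarrow> (\<exists>m<k. w ! m = x)"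
  by (auto simp: in_set_conv_nth)

section \<open>The bijection between linear extensions and nonnesting permutations\<close>

locale one_line =
  fixes n :: nat and \<sigma> :: "nat list"
  assumes sym: "\<sigma> \<in> sym_perms n"
begin

abbreviation "exts \<equiv> lin_exts (ladder n) (ladder_edges n)"

definition letter :: "nat \<times> bool \<Rightarrow> nat" where
  "letter v = \<sigma> ! fst v"

lemma distinct_sigma: "distinct \<sigma>" and set_sigma: "set \<sigma> = {1..n}"
  using sym by (auto simp: sym_perms_def dest: permutations_of_setD)

lemma length_sigma: "length \<sigma> = n"
  using distinct_card[OF distinct_sigma] set_sigma by simp

lemma nth_sigma: "i < n \<Longrightarrow> 1 \<le> \<sigma> ! i \<and> \<sigma> ! i \<le> n"
  using nth_mem[of i \<sigma>] length_sigma set_sigma by auto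

lemma nth_sigma_eq: "i < n \<Longrightarrow> j < n \<Longrightarrow> \<sigma> ! i = \<sigma> ! j \<longleftrightarrow> i = j"
  using distinct_sigma length_sigma by (simp add: nth_eq_iff_index_eq)

lemma fst_nth_exts: "w \<in> exts \<Longrightarrow> k < length w \<Longrightarrow> fst (w ! k) < n"
  using nth_mem[of k w] by (simp add: lin_exts_def ladder_def mem_Times_iff)

lemma ex_nth_exts:
  assumes "w \<in> exts" "i < n"
  obtains k where "k < length w" "w ! k = (i, b)"
proof -
  have "(i, b) \<in> set w" using assms by (auto simp: lin_exts_def ladder_def)
  then show ?thesis using that by (auto simp: in_set_conv_nth)
qed

lemma exts_nth_eq: "w \<in> exts \<Longrightarrow> k < length w \<Longrightarrow> l < length w \<Longrightarrow> w ! k = w ! l \<longleftrightarrow> k = l"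
  by (auto simp: lin_exts_def nth_eq_iff_index_eq)

lemma same_letter:
  assumes "w \<in> exts" "k < l" "l < length w" "letter (w ! k) = letter (w ! l)"
  shows "\<exists>i<n. w ! k = (i, False) \<and> w ! l = (i, True)"
proof -
  obtain i b j c where w: "w ! k = (i, b)" "w ! l = (j, c)" by force
  have "i < n" "j < n" using fst_nth_exts[OF assms(1), of k] fst_nth_exts[OF assms(1), of l] assms(2,3) w by auto
  then have "i = j" using assms(4) w nth_sigma_eq by (simp add: letter_def)
  moreover have "b \<noteq> c" using exts_nth_eq[of w k l] assms w \<open>i = j\<close> by auto
  moreover have "\<not> b" using ladder_order_rung[of w n l k i] assms w \<open>i = j\<close> \<open>b \<noteq> c\<close> by auto
  ultimately show ?thesis using w \<open>i < n\<close> by auto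
qed

text \<open>The rail of a vertex can thus be read off the bare word of letters; the letter itself
  gives the column, whence injectivity.\<close>

lemma second_copy_iff:
  assumes "w \<in> exts" "k < length w"
  shows "snd (w ! k) \<longleftrightarrow> map letter w ! k \<in> set (take k (map letter w))"
proof
  obtain i b where w: "w ! k = (i, b)" by force
  assume "snd (w ! k)"
  then have "w ! k = (i, True)" using w by simp
  moreover obtain m where m: "m < length w" "w ! m = (i, False)"
    using ex_nth_exts[OF assms(1), of i False] fst_nth_exts[OF assms] w by auto
  ultimately have "m < k" using ladder_order_rung assms by blast
  then show "map letter w ! k \<in> set (take k (map letter w))"
    using assms m w by (auto simp: in_set_take_conv_nth letter_def intro!: exI[of _ m])
next
  assume "map letter w ! k \<in> set (take k (map letter w))"
  then obtain m where m: "m < k" "letter (w ! m) = letter (w ! k)"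
    using assms by (auto simp: in_set_take_conv_nth)
  then show "snd (w ! k)" using same_letter[OF assms(1) m(1) assms(2) m(2)] by auto
qed

lemma inj_on_map_letter: "inj_on (map letter) exts"
proof (rule inj_onI)
  fix w w' assume w: "w \<in> exts" "w' \<in> exts" "map letter w = map letter w'"
  then have len: "length w = length w'" by (metis length_map)
  show "w = w'"
  proof (rule nth_equalityI[OF len])
    fix k assume k: "k < length w"
    then have k': "k < length w'" using len by simp
    have "letter (w ! k) = letter (w' ! k)" using w(3) k k' by (metis nth_map)
    then have "fst (w ! k) = fst (w' ! k)"
      using fst_nth_exts[OF w(1) k] fst_nth_exts[OF w(2) k'] nth_sigma_eq by (simp add: letter_def)
    moreover have "snd (w ! k) = snd (w' ! k)"
      using second_copy_iff[OF w(1) k] second_copy_iff[OF w(2) k'] w(3) by simp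
    ultimately show "w ! k = w' ! k" by (rule prod_eqI)
  qed
qed

lemma mset_map_letter:
  assumes "w \<in> exts"
  shows "mset (map letter w) = mset_set {1..n} + mset_set {1..n}"
proof -
  \<comment> \<open>Every extension rearranges the two rails written one after the other, whose
    letters read \<open>\<sigma> @ \<sigma>\<close>.\<close>
  let ?w = "map (\<lambda>i. (i, False)) [0..<n] @ map (\<lambda>i. (i, True)) [0..<n]"
  have "set ?w = ladder n" by (auto simp: ladder_def)
  moreover have "distinct ?w" by (auto simp: distinct_map inj_on_def)
  ultimately have "mset w = mset ?w"
    using assms set_eq_iff_mset_eq_distinct[of w ?w] by (auto simp: lin_exts_def)
  then have "mset (map letter w) = mset (map letter ?w)" by (simp only: mset_map)
  also have "map letter ?w = \<sigma> @ \<sigma>"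
    using map_nth[of \<sigma>] by (simp add: comp_def letter_def length_sigma)
  also have "mset (\<sigma> @ \<sigma>) = mset_set {1..n} + mset_set {1..n}"
    using mset_set_set[OF distinct_sigma] set_sigma by simp
  finally show ?thesis .
qed

text \<open>For a nesting with outer column \<open>a\<close> and inner column \<open>c\<close>, the
  first rail excludes \<open>c < a\<close>, the second excludes \<open>a < c\<close>, and
  distinctness of the word excludes equality.\<close>

lemma nonnesting_map_letter:
  assumes "w \<in> exts"
  shows "nonnesting (map letter w)"
  unfolding nonnesting_def
proof (intro notI, elim exE conjE)
  fix i j l m
  assume *: "i < j" "j < l" "l < m" "m < length (map letter w)"
    "map letter w ! i = map letter w ! m" "map letter w ! j = map letter w ! l"
  obtain a where a: "w ! i = (a, False)" "w ! m = (a, True)"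
    using same_letter[OF assms, of i m] * by auto
  obtain c where c: "w ! j = (c, False)" "w ! l = (c, True)"
    using same_letter[OF assms, of j l] * by auto
  have "\<not> c < a" using ladder_order[OF assms, of j i c False a] a c * by auto
  moreover have "\<not> a < c" using ladder_order[OF assms, of m l a True c] a c * by auto
  moreover have "a \<noteq> c" using exts_nth_eq[OF assms, of i j] a c * by auto
  ultimately show False by simp
qed

lemma first_copies_map_letter:
  assumes "w \<in> exts"
  shows "first_copies (map letter w) = \<sigma>"
proof -
  let ?F = "filter (\<lambda>v. \<not> snd v) w"
  have "filter (\<lambda>k. map letter w ! k \<notin> set (take k (map letter w))) [0..<length w]
      = filter (\<lambda>k. \<not> snd (w ! k)) [0..<length w]"
    by (rule filter_cong) (use second_copy_iff[OF assms] in auto)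
  then have "first_copies (map letter w) =
      map ((!) (map letter w)) (filter (\<lambda>k. \<not> snd (w ! k)) [0..<length w])"
    by (simp add: first_copies_conv_filter)
  also have "\<dots> = map letter (map ((!) w) (filter (\<lambda>k. \<not> snd (w ! k)) [0..<length w]))"
    by simp
  also have "map ((!) w) (filter (\<lambda>k. \<not> snd (w ! k)) [0..<length w]) = ?F"
    using filter_map[of "\<lambda>v. \<not> snd v" "(!) w" "[0..<length w]"] by (simp add: map_nth comp_def)
  finally have *: "first_copies (map letter w) = map ((!) \<sigma>) (map fst ?F)"
    by (simp add: letter_def[abs_def] comp_def)
  have "sorted_wrt (\<lambda>u v. snd u = snd v \<longrightarrow> fst u < fst v) w"
    unfolding sorted_wrt_iff_nth_less
  proof (intro allI impI)
    fix k l assume kl: "k < l" "l < length w" "snd (w ! k) = snd (w ! l)"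
    then have "w ! k \<noteq> w ! l" using exts_nth_eq[OF assms, of k l] by auto
    then have "fst (w ! k) \<noteq> fst (w ! l)" using kl(3) by (auto simp: prod_eq_iff)
    moreover have "\<not> fst (w ! l) < fst (w ! k)"
      using ladder_order[OF assms, of l k "fst (w ! l)" "snd (w ! l)" "fst (w ! k)"] kl
      by (auto simp: prod_eq_iff)
    ultimately show "fst (w ! k) < fst (w ! l)" by simp
  qed
  then have "sorted_wrt (\<lambda>u v. snd u = snd v \<longrightarrow> fst u < fst v) ?F"
    by (rule sorted_wrt_filter)
  then have "sorted_wrt (\<lambda>u v. fst u < fst v) ?F"
    by (rule sorted_wrt_mono_rel[rotated]) auto
  then have "sorted_wrt (<) (map fst ?F)" by (simp add: sorted_wrt_map)
  moreover have "set (map fst ?F) = set [0..<n]"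
  proof -
    have "set w = {..<n} \<times> UNIV" using assms by (simp add: lin_exts_def ladder_def)
    then show ?thesis by force
  qed
  \<comment> \<open>A strictly increasing list is determined by its set.\<close>
  ultimately have "map fst ?F = [0..<n]"
    by (metis strict_sorted_equal sorted_wrt_upt)
  then show ?thesis using * map_nth[of \<sigma>] by (simp add: length_sigma)
qed

text \<open>The preimage replaces each letter by its column in \<open>\<sigma>\<close> together with
  the flag telling whether the letter has occurred before.\<close>

lemma ex_exts_map_letter:
  assumes "w \<in> nonnesting_perms_over n \<sigma>"
  shows "\<exists>v\<in>exts. map letter v = w"
proof -
  have mset: "mset w = mset_set {1..n} + mset_set {1..n}"
    and nonnest: "nonnesting w" and first: "first_copies w = \<sigma>"
    using assms by (auto simp: nonnesting_perms_over_def nonnesting_perms_def permutations_of_multiset_def)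
  have len: "length w = 2 * n" using arg_cong[OF mset, of size] by simp
  have setw: "set w = {1..n}" using arg_cong[OF mset, of set_mset] by simp
  define pos where "pos = the_inv_into {..<n} ((!) \<sigma>)"
  have inj: "inj_on ((!) \<sigma>) {..<n}" using nth_sigma_eq by (auto simp: inj_on_def)
  have pos_nth: "pos (\<sigma> ! i) = i" if "i < n" for i
    unfolding pos_def using the_inv_into_f_f[OF inj, of i] that by simp
  have pos: "pos (w ! k) < n" "\<sigma> ! pos (w ! k) = w ! k" if "k < length w" for k
  proof -
    have "w ! k \<in> set \<sigma>" using that setw set_sigma nth_mem by blast
    then obtain i where "i < n" "\<sigma> ! i = w ! k" by (auto simp: in_set_conv_nth length_sigma)
    then show "pos (w ! k) < n" "\<sigma> ! pos (w ! k) = w ! k" using pos_nth by metis+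
  qed
  have pos_eq: "w ! k = w ! l" if "pos (w ! k) = pos (w ! l)" "k < length w" "l < length w" for k l
    using pos(2)[OF that(2)] pos(2)[OF that(3)] that(1) by metis
  define snd_copy where "snd_copy = (\<lambda>k. w ! k \<in> set (take k w))"
  have snd_copy_iff: "snd_copy k \<longleftrightarrow> (\<exists>m<k. w ! m = w ! k)" if "k < length w" for k
    using that by (simp add: snd_copy_def in_set_take_conv_nth)
  define P where "P = filter (\<lambda>k. \<not> snd_copy k) [0..<length w]"
  have P: "map ((!) w) P = \<sigma>"
    using first by (simp add: first_copies_conv_filter P_def snd_copy_def)
  \<comment> \<open>\<open>P\<close> lists the positions of first copies in increasing order, and
    its entry with index \<open>a\<close> carries the letter \<open>\<sigma> ! a\<close>.\<close>
  have first_order: "pos (w ! k) < pos (w ! l)"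
    if kl: "k < l" "l < length w" "\<not> snd_copy k" "\<not> snd_copy l" for k l
  proof -
    have "k \<in> set P" "l \<in> set P" using kl by (auto simp: P_def)
    then obtain a b where a: "a < length P" "P ! a = k" and b: "b < length P" "P ! b = l"
      by (auto simp: in_set_conv_nth)
    have lenP: "length P = n" using arg_cong[OF P, of length] length_sigma by simp
    have "sorted_wrt (<) P" unfolding P_def by (intro sorted_wrt_filter sorted_wrt_upt)
    then have "a < b"
      using a b kl(1) sorted_wrt_nth_less[of "(<)" P b a] by (cases a b rule: linorder_cases) auto
    moreover have "pos (w ! k) = a" "pos (w ! l) = b"
      using a b lenP pos_nth[of a] pos_nth[of b] by (auto simp flip: P)
    ultimately show ?thesis by simp
  qed
  have first_copy: "\<exists>m<k. \<not> snd_copy m \<and> w ! m = w ! k" if k: "k < length w" "snd_copy k" for k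
  proof -
    define m where "m = (LEAST m. w ! m = w ! k)"
    have m: "w ! m = w ! k" unfolding m_def by (rule LeastI) simp
    obtain m' where "m' < k" "w ! m' = w ! k" using k snd_copy_iff by blast
    then have "m < k" unfolding m_def by (meson Least_le le_less_trans)
    moreover have "\<not> snd_copy m"
    proof
      assume "snd_copy m"
      then obtain m'' where "m'' < m" "w ! m'' = w ! m"
        using snd_copy_iff[of m] \<open>m < k\<close> k by auto
      then show False using m not_less_Least[of m'' "\<lambda>m. w ! m = w ! k"] by (simp add: m_def)
    qed
    ultimately show ?thesis using m by blast
  qed
  \<comment> \<open>Two equal letters both flagged as second copies would require a third
    occurrence, which the multiset excludes.\<close>
  have no_third: False if "m < k" "k < l" "l < length w" "w ! m = w ! k" "w ! l = w ! k" for m k l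
  proof -
    have "card {m, k, l} \<le> card {i. i < length w \<and> w ! k = w ! i}"
      by (rule card_mono) (use that in auto)
    also have "\<dots> = count (mset w) (w ! k)"
      by (simp add: count_mset length_filter_conv_card count_list_eq_length_filter)
    also have "\<dots> \<le> 2" unfolding mset by (simp add: count_mset_set')
    finally show False using that by simp
  qed
  define v where "v = map (\<lambda>k. (pos (w ! k), snd_copy k)) [0..<length w]"
  have map_v: "map letter v = w"
    by (rule nth_equalityI) (use pos in \<open>auto simp: v_def letter_def\<close>)
  have "inj_on (\<lambda>k. (pos (w ! k), snd_copy k)) {0..<length w}"
  proof (rule linorder_inj_onI)
    fix k l assume "k < l" "k \<in> {0..<length w}" "l \<in> {0..<length w}"
    then have kl: "k < l" "l < length w" by auto
    show "(pos (w ! k), snd_copy k) \<noteq> (pos (w ! l), snd_copy l)"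
    proof
      assume "(pos (w ! k), snd_copy k) = (pos (w ! l), snd_copy l)"
      then have eq: "w ! k = w ! l" "snd_copy k = snd_copy l"
        using pos_eq[of k l] kl by auto
      then have "snd_copy k" using kl(1) snd_copy_iff[OF kl(2)] by blast
      then obtain m where "m < k" "w ! m = w ! k" using snd_copy_iff[of k] kl by auto
      then show False using no_third kl eq(1)[symmetric] by blast
    qed
  qed auto
  then have dist: "distinct v" by (simp add: v_def distinct_map)
  have "set v \<subseteq> ladder n" using pos by (auto simp: v_def ladder_def)
  moreover have "card (set v) = card (ladder n)"
    using distinct_card[OF dist] len by (simp add: v_def ladder_def card_cartesian_product)
  ultimately have set_v: "set v = ladder n" by (simp add: card_subset_eq finite_ladder)
  have "sorted_wrt (\<lambda>x y. (y, x) \<notin> ladder_edges n) v"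
    unfolding sorted_wrt_iff_nth_less
  proof (intro allI impI notI)
    fix k l assume "k < l" "l < length v" and e: "(v ! l, v ! k) \<in> ladder_edges n"
    then have kl: "k < l" "l < length w" by (auto simp: v_def)
    then have v: "v ! k = (pos (w ! k), snd_copy k)" "v ! l = (pos (w ! l), snd_copy l)"
      by (auto simp: v_def)
    consider "pos (w ! k) = Suc (pos (w ! l))" "snd_copy k = snd_copy l"
      | "pos (w ! k) = pos (w ! l)" "\<not> snd_copy l"
      using e v by (auto simp: ladder_edges_def)
    then show False
    proof cases
      case 1
      show False
      proof (cases "snd_copy l")
        case False
        then show False using first_order[OF kl] 1 by simp
      next
        case True
        then obtain k0 l0 where k0: "k0 < k" "\<not> snd_copy k0" "w ! k0 = w ! k"
          and l0: "l0 < l" "\<not> snd_copy l0" "w ! l0 = w ! l"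
          using first_copy[of k] first_copy[of l] 1 kl by auto
        have "k0 \<noteq> l0" using k0 l0 1 by auto
        moreover have "\<not> k0 < l0" using first_order[of k0 l0] k0 l0 1 kl by auto
        ultimately have "l0 < k0" by simp
        \<comment> \<open>Here \<open>l0 < k0 < k < l\<close>: the pair of equal letters at
          \<open>k0\<close> and \<open>k\<close> is nested inside the pair at \<open>l0\<close> and
          \<open>l\<close>.\<close>
        then show False using nonnest k0 l0 kl unfolding nonnesting_def by blast
      qed
    next
      case 2
      then have "w ! k = w ! l" using pos_eq[of k l] kl by auto
      then show False using 2 snd_copy_iff[of l] kl by auto
    qed
  qed
  then have "v \<in> exts" using dist set_v by (simp add: lin_exts_def)
  then show ?thesis using map_v by blast
qed

lemma bij_betw_map_letter: "bij_betw (map letter) exts (nonnesting_perms_over n \<sigma>)"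
proof (rule bij_betw_imageI[OF inj_on_map_letter])
  show "map letter ` exts = nonnesting_perms_over n \<sigma>"
  proof
    show "nonnesting_perms_over n \<sigma> \<subseteq> map letter ` exts"
      using ex_exts_map_letter by blast
    show "map letter ` exts \<subseteq> nonnesting_perms_over n \<sigma>"
      using mset_map_letter nonnesting_map_letter first_copies_map_letter
      by (simp add: image_subset_iff nonnesting_perms_over_def nonnesting_perms_def
          permutations_of_multiset_def del: mset_map)
  qed
qed

section \<open>Labels for weak descents and their complement\<close>

definition lab :: "nat \<times> bool \<Rightarrow> nat" where
  "lab v = 2 * \<sigma> ! fst v + of_bool (\<not> snd v)"

text \<open>Equal neighbours are a first copy followed by its second copy, whose label is one
  smaller, so they become a strict descent. Doubling leaves comparisons of different letters
  intact.\<close>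

lemma wdes_map_letter:
  assumes "w \<in> exts"
  shows "wdes (map letter w) = des (map lab w)"
proof -
  have "letter (w ! k) \<ge> letter (w ! Suc k) \<longleftrightarrow> lab (w ! k) > lab (w ! Suc k)"
    if "Suc k < length w" for k
  proof (cases "letter (w ! k) = letter (w ! Suc k)")
    case True
    then show ?thesis using same_letter[OF assms, of k "Suc k"] that by (auto simp: lab_def)
  next
    case False
    then show ?thesis by (auto simp: lab_def letter_def)
  qed
  then show ?thesis unfolding wdes_def des_def
    by (intro arg_cong[of _ _ card]) auto
qed

lemma lab_le: "v \<in> ladder n \<Longrightarrow> lab v \<le> 2 * n + 1"
  using nth_sigma by (fastforce simp: lab_def ladder_def)

lemma inj_on_lab: "inj_on lab (ladder n)"
proof (rule inj_onI)
  fix u v assume "u \<in> ladder n" "v \<in> ladder n" "lab u = lab v"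
  moreover from this have "\<sigma> ! fst u = \<sigma> ! fst v" "snd u = snd v"
    by (auto simp: lab_def of_bool_def split: if_splits) presburger+
  ultimately show "u = v" using nth_sigma_eq by (auto simp: ladder_def prod_eq_iff)
qed

lemma parallel_lab: "parallel n lab"
  unfolding parallel_def using inj_on_lab by (auto simp: lab_def)

text \<open>The extra one is the rung cut, since all rungs descend under \<open>lab\<close>.\<close>

lemma cut_number_lab: "cut_number n lab = des \<sigma> + 1"
  by (simp add: cut_number_def inverted_columns_def lab_def des_def length_sigma)

abbreviation "colab \<equiv> (\<lambda>v. 2 * n + 1 - lab v)"

lemma colab_less_iff:
  "u \<in> ladder n \<Longrightarrow> v \<in> ladder n \<Longrightarrow> colab u < colab v \<longleftrightarrow> lab v < lab u"
  using lab_le[of u] lab_le[of v] by auto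

lemma parallel_colab: "parallel n colab"
  unfolding parallel_def
proof (intro conjI allI impI)
  show "inj_on colab (ladder n)"
  proof (rule inj_onI)
    fix u v assume "u \<in> ladder n" "v \<in> ladder n" "colab u = colab v"
    then show "u = v" using lab_le[of u] lab_le[of v] inj_onD[OF inj_on_lab, of u v] by auto
  qed
next
  fix i assume "Suc i < n"
  then show "colab (i, False) < colab (Suc i, False) \<longleftrightarrow> colab (i, True) < colab (Suc i, True)"
    by (subst (1 2) colab_less_iff) (auto simp: ladder_def lab_def)
next
  fix i assume "i < n"
  then show "colab (i, False) < colab (i, True) \<longleftrightarrow> colab (0, False) < colab (0, True)"
    by (subst (1 2) colab_less_iff) (auto simp: ladder_def lab_def)
qed

text \<open>Complementing makes the rungs ascend and turns the ascents of \<open>\<sigma>\<close>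
  into the inverted columns.\<close>

lemma cut_number_colab:
  assumes "n > 0"
  shows "int (cut_number n colab) = int n - 1 - int (des \<sigma>)"
proof -
  have "inverted_columns n colab = {..<n - 1} - inverted_columns n lab"
  proof (rule set_eqI)
    fix i
    show "i \<in> inverted_columns n colab \<longleftrightarrow> i \<in> {..<n - 1} - inverted_columns n lab"
    proof (cases "Suc i < n")
      case True
      then have "\<sigma> ! i \<noteq> \<sigma> ! Suc i" using nth_sigma_eq by simp
      then have "lab (i, False) < lab (Suc i, False) \<longleftrightarrow> \<not> lab (Suc i, False) < lab (i, False)"
        by (auto simp: lab_def)
      moreover have "colab (Suc i, False) < colab (i, False) \<longleftrightarrow> lab (i, False) < lab (Suc i, False)"
        using True by (intro colab_less_iff) (auto simp: ladder_def)
      ultimately show ?thesis using True by (auto simp: inverted_columns_def)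
    qed (auto simp: inverted_columns_def)
  qed
  moreover have sub: "inverted_columns n lab \<subseteq> {..<n - 1}" by (auto simp: inverted_columns_def)
  ultimately have "int (card (inverted_columns n colab)) = int (n - 1) - int (card (inverted_columns n lab))"
    using card_mono[OF _ sub] by (simp add: card_Diff_subset)
  moreover have "card (inverted_columns n lab) = des \<sigma>"
    by (simp add: inverted_columns_def lab_def des_def length_sigma)
  moreover have "\<not> colab (0, True) < colab (0, False)"
    using assms by (subst colab_less_iff) (auto simp: ladder_def lab_def)
  ultimately show ?thesis using assms by (simp add: cut_number_def)
qed

text \<open>A word of length \<open>2 * n\<close> has \<open>2 * n - 1\<close> adjacent pairs, each
  a descent for exactly one of the labellings.\<close>

lemma des_count_colab:
  assumes "n > 0"
  shows "des_count (ladder n) (ladder_edges n) colab r =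
    des_count (ladder n) (ladder_edges n) lab (2 * int n - 1 - r)"
proof -
  have "int (des (map colab w)) = r \<longleftrightarrow> int (des (map lab w)) = 2 * int n - 1 - r" if "w \<in> exts" for w
  proof -
    have w: "distinct w" "set w = ladder n" using that by (auto simp: lin_exts_def)
    have "length w = 2 * n"
      using distinct_card[OF w(1)] w(2) by (simp add: ladder_def card_cartesian_product)
    then have "des (map colab w) + des (map lab w) = 2 * n - 1"
      using des_complement[of w lab "2 * n + 1"] w inj_on_lab lab_le by auto
    then show ?thesis using assms by linarith
  qed
  then show ?thesis unfolding des_count_def
    by (intro arg_cong[of _ _ card] Collect_cong conj_cong refl) simp
qed

lemma card_wdes:
  "card {w \<in> nonnesting_perms_over n \<sigma>. int (wdes w) - int (des \<sigma>) = r} =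
    des_count (ladder n) (ladder_edges n) lab (r + int (des \<sigma>))"
proof -
  have "bij_betw (map letter) {w \<in> exts. int (des (map lab w)) = r + int (des \<sigma>)}
      {w \<in> nonnesting_perms_over n \<sigma>. int (wdes w) - int (des \<sigma>) = r}"
    using bij_betw_map_letter
    by (rule bij_betw_Collect) (use wdes_map_letter in auto)
  then show ?thesis unfolding des_count_def by (rule bij_betw_same_card[symmetric])
qed

end

theorem corollary2p7:
  fixes n :: nat and \<sigma> :: "nat list" and r :: int
  assumes "n \<ge> 1" and "\<sigma> \<in> sym_perms n"
  shows "card {\<pi> \<in> nonnesting_perms_over n \<sigma>. int (wdes \<pi>) - int (des \<sigma>) = r} =
         card {\<pi> \<in> nonnesting_perms_over n \<sigma>. int (wdes \<pi>) - int (des \<sigma>) = int n + 1 - r}"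
proof -
  interpret one_line n \<sigma> by unfold_locales (rule assms(2))
  let ?D = "des_count (ladder n) (ladder_edges n)"
  have n: "n > 0" using assms(1) by simp
  \<comment> \<open>Both labellings are compared with the reference labelling at level
    \<open>r - 1\<close>, the offset being the rung cut of \<open>lab\<close>.\<close>
  have "?D lab (r + int (des \<sigma>)) = ?D (\<lambda>(i, b). 2 * i + of_bool b) (r - 1)"
    using des_count_parallel[OF n parallel_lab, of "r - 1"] by (simp add: cut_number_lab)
  also have "\<dots> = ?D colab (r - 1 + (int n - 1 - int (des \<sigma>)))"
    using des_count_parallel[OF n parallel_colab, of "r - 1"] by (simp only: cut_number_colab[OF n])
  \<comment> \<open>Complementing sends the level \<open>r + n - 2 - des \<sigma>\<close> to
    \<open>2 * n - 1\<close> minus it.\<close>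
  also have "\<dots> = ?D lab (int n + 1 - r + int (des \<sigma>))"
    unfolding des_count_colab[OF n] by (rule arg_cong[of _ _ "?D lab"]) simp
  finally show ?thesis unfolding card_wdes .
qed

end
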